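(* Let $\Sigma\subset\mathbb{R}^2$ be a domain, $f\colon\Sigma\to\mathbb{R}^3$ a front and $p\in\Sigma$ a singular point of the second kind of $f$. If the Gaussian curvature $K$ of $f$ is rationally continuous at $p$, then $p$ is a sub-parabolic point of $f$.
   Context: Fronts. A $C^\infty$ map $f\colon\Sigma\to\mathbb{R}^3$ ($\Sigma\subset\mathbb{R}^2$ a domain) is a frontal if there is a $C^\infty$ map $\nu\colon\Sigma\to S^2$ (unit normal, Gauss map) with $\langle df_q(X),\nu(q)\rangle=0$ for all $q\in\Sigma$, $X\in T_q\Sigma$; it is a front if moreover $(f,\nu)\colon\Sigma\to\mathbb{R}^3\times S^2$ is an immersion. $S(f)$ is the set of points where $f$ is not an immersion, and $\lambda=\det(f_u,f_v,\nu)$, so $S(f)=\lambda^{-1}(0)$. A point $p\in S(f)$ is non-degenerate if $d\lambda(p)\neq0$; then near $p$ the set $S(f)$ is a regular curve $\gamma$ (singular curve) with $\gamma(0)=p$, $\operatorname{rank}df_p=1$, and there is a never-vanishing vector field $\eta$ near $p$ (null vector field) with $df_q(\eta_q)=0$ for $q\in S(f)$. A non-degenerate $p$ is of the first kind if $\gamma'(0)$ and $\eta_p$ are linearly independent, otherwise of the second kind. The Gaussian curvature $K$ is defined on the set of regular points of $f$. Coordinates at a singular point of the second kind $p$ of a front. A local coordinate system $(U;u,v)$ centered at $p$ is adapted if $f_u(p)=0$, the $u$-axis is the singular curve on $U$, and $|f_v(p)|=1$; it is strongly adapted if moreover $\langle f_{uv},f_v\rangle(p)=0$. Take a strongly adapted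 one, with $U$ sufficiently small. There are a $C^\infty$ function $e(u)$ with $e(0)=0$ such that $\eta=\partial_u+e(u)\partial_v$ is a null vector field, and a $C^\infty$ map $h\colon U\to\mathbb{R}^3$ with $f_u+e(u)f_v=vh$; $h$ and $f_v$ are linearly independent, and $\nu=(h\times f_v)/|h\times f_v|$ is chosen (so $\lambda_v(p)>0$). Put $\widehat F=\langle h,f_v\rangle$, $\widehat G=\langle f_v,f_v\rangle$, $\widehat M=-\langle h,\nu_v\rangle$, $\widehat N=-\langle f_v,\nu_v\rangle$. Principal curvatures, sub-parabolic points. The principal curvatures of $f$ on $U\setminus S(f)$ are the roots $k$ of $\det(\widehat{II}-k\hat I)=0$, where $\hat I$ and $\widehat{II}$ are the $2\times2$ matrices with entries $\langle f_{x_i},f_{x_j}\rangle$ and $-\langle f_{x_i},\nu_{x_j}\rangle$, $(x_1,x_2)=(u,v)$. It is known that exactly one of them extends to a bounded $C^\infty$ function $\kappa$ on $U$ (bounded principal curvature), while the other, $\tilde\kappa$ (unbounded principal curvature), is unbounded near $p$, and that $\hat\kappa:=\lambda\tilde\kappa$ extends to a $C^\infty$ function on $U$ with $\hat\kappa(p)\neq0$. The principal vector associated to $\tilde\kappa$ is the vector field $\widetilde V=\widetilde V_1\partial_u+\big(-v(\lambda\widehat M-\hat\kappa\widehat F)+e(u)\widetilde V_1\big)\partial_v$ with $\widetilde V_1=\lambda\widehat N-\hat\kappa\widehat G$. The point $p$ is a sub-parabolic point of $f$ (with respect to $\kappa$) if the directional derivative $\widetilde V\kappa$ vanishes at $p$.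 Rational continuity. Let $\varphi$ be a continuous real function defined on the complement of the singular set in a neighborhood of $p$. Take local coordinates $(u,v)$ centered at $p$ and write $u=r\cos\theta$, $v=r\sin\theta$. Then $\varphi$ is rationally bounded at $p$ if there are $\varepsilon>0$ and continuous functions $a(r,\theta),b(r,\theta)$ on $[0,\varepsilon)\times(\mathbb{R}/2\pi\mathbb{Z})$ such that $\{\theta: b(0,\theta)=0\}$ is finite and $\varphi(r\cos\theta,r\sin\theta)=a(r,\theta)/b(r,\theta)$ for $r>0$ wherever $b(r,\theta)\neq0$ and $\varphi$ is defined. It is rationally continuous at $p$ if, moreover, $a(0,\theta)/b(0,\theta)$ is constant in $\theta$ where $b(0,\theta)\neq0$. *)

theory Defs
  imports "HOL-Analysis.Analysis"
begin

section \<open>Smooth maps and partial derivatives\<close>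

text \<open>On an open set, existence and continuity of all iterated directional derivatives of
  order at most \<open>k\<close> is the usual notion of class \<open>C\<^sup>k\<close>. The sets below are always open.\<close>

primrec Ck_on :: "nat \<Rightarrow> 'a::euclidean_space set \<Rightarrow> ('a \<Rightarrow> 'b::real_normed_vector) \<Rightarrow> bool" where
  "Ck_on 0 S g \<longleftrightarrow> continuous_on S g"
| "Ck_on (Suc k) S g \<longleftrightarrow> (\<forall>x\<in>S. g differentiable (at x)) \<and>
     (\<forall>X. Ck_on k S (\<lambda>x. frechet_derivative g (at x) X))"

definition smooth_on :: "'a::euclidean_space set \<Rightarrow> ('a \<Rightarrow> 'b::real_normed_vector) \<Rightarrow> bool" where
  "smooth_on S g \<longleftrightarrow> (\<forall>k. Ck_on k S g)"

definition du :: "(real \<times> real \<Rightarrow> 'b::real_normed_vector) \<Rightarrow> real \<times> real \<Rightarrow> 'b" where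
  "du g q = frechet_derivative g (at q) (1, 0)"

definition dv :: "(real \<times> real \<Rightarrow> 'b::real_normed_vector) \<Rightarrow> real \<times> real \<Rightarrow> 'b" where
  "dv g q = frechet_derivative g (at q) (0, 1)"

text \<open>The condition \<open>x \<noteq> y\<close> is needed because \<open>{x, x}\<close> is a singleton.\<close>

definition lin_indep_pair :: "'a::real_vector \<Rightarrow> 'a \<Rightarrow> bool" where
  "lin_indep_pair x y \<longleftrightarrow> x \<noteq> y \<and> independent {x, y}"

definition immersion_at :: "('a::real_normed_vector \<Rightarrow> 'b::real_normed_vector) \<Rightarrow> 'a \<Rightarrow> bool" where
  "immersion_at g q \<longleftrightarrow> g differentiable (at q) \<and> inj (frechet_derivative g (at q))"


section \<open>Fronts and their singular points\<close>

text \<open>\<open>\<nu>\<close> takes values in the unit sphere, so \<open>(f, \<nu>)\<close> is an immersion into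
  \<open>\<real>\<^sup>3 \<times> S\<^sup>2\<close> iff it is one into \<open>\<real>\<^sup>3 \<times> \<real>\<^sup>3\<close>.\<close>

definition frontal_on :: "(real \<times> real) set \<Rightarrow> (real \<times> real \<Rightarrow> real^3) \<Rightarrow> (real \<times> real \<Rightarrow> real^3) \<Rightarrow> bool" where
  "frontal_on \<Sigma> f \<nu> \<longleftrightarrow> smooth_on \<Sigma> f \<and> smooth_on \<Sigma> \<nu> \<and>
     (\<forall>q\<in>\<Sigma>. norm (\<nu> q) = 1 \<and> (\<forall>X. frechet_derivative f (at q) X \<bullet> \<nu> q = 0))"

definition front_on :: "(real \<times> real) set \<Rightarrow> (real \<times> real \<Rightarrow> real^3) \<Rightarrow> (real \<times> real \<Rightarrow> real^3) \<Rightarrow> bool" where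
  "front_on \<Sigma> f \<nu> \<longleftrightarrow> frontal_on \<Sigma> f \<nu> \<and> (\<forall>q\<in>\<Sigma>. immersion_at (\<lambda>x. (f x, \<nu> x)) q)"

definition singular_set :: "(real \<times> real) set \<Rightarrow> (real \<times> real \<Rightarrow> real^3) \<Rightarrow> (real \<times> real) set" where
  "singular_set \<Sigma> f = {q \<in> \<Sigma>. \<not> immersion_at f q}"

definition signed_area_density :: "(real \<times> real \<Rightarrow> real^3) \<Rightarrow> (real \<times> real \<Rightarrow> real^3) \<Rightarrow> real \<times> real \<Rightarrow> real" where
  "signed_area_density f \<nu> q = det (vector [du f q, dv f q, \<nu> q] :: real^3^3)"

definition nondegenerate_singular_point ::
  "(real \<times> real) set \<Rightarrow> (real \<times> real \<Rightarrow> real^3) \<Rightarrow> (real \<times> real \<Rightarrow> real^3) \<Rightarrow> real \<times> real \<Rightarrow> bool" where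
  "nondegenerate_singular_point \<Sigma> f \<nu> p \<longleftrightarrow> p \<in> singular_set \<Sigma> f \<and>
     frechet_derivative (signed_area_density f \<nu>) (at p) \<noteq> (\<lambda>X. 0)"

definition singular_curve ::
  "(real \<times> real) set \<Rightarrow> (real \<times> real \<Rightarrow> real^3) \<Rightarrow> real \<times> real \<Rightarrow> (real \<Rightarrow> real \<times> real) \<Rightarrow> bool" where
  "singular_curve \<Sigma> f p \<gamma> \<longleftrightarrow> (\<exists>\<epsilon>>0. \<exists>W. open W \<and> p \<in> W \<and> W \<subseteq> \<Sigma> \<and> \<gamma> 0 = p \<and>
     smooth_on {-\<epsilon><..<\<epsilon>} \<gamma> \<and> inj_on \<gamma> {-\<epsilon><..<\<epsilon>} \<and>
     (\<forall>t\<in>{-\<epsilon><..<\<epsilon>}. vector_derivative \<gamma> (at t) \<noteq> 0) \<and>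
     \<gamma> ` {-\<epsilon><..<\<epsilon>} = singular_set W f)"

definition null_vector_field ::
  "(real \<times> real) set \<Rightarrow> (real \<times> real \<Rightarrow> real^3) \<Rightarrow> (real \<times> real \<Rightarrow> real \<times> real) \<Rightarrow> bool" where
  "null_vector_field W f \<eta> \<longleftrightarrow> smooth_on W \<eta> \<and> (\<forall>q\<in>W. \<eta> q \<noteq> 0) \<and>
     (\<forall>q\<in>singular_set W f. frechet_derivative f (at q) (\<eta> q) = 0)"

text \<open>Near a non-degenerate point a singular curve and a null vector field exist, and the lines
  spanned by \<open>\<gamma>'(0)\<close> and \<open>\<eta>\<^sub>p\<close> do not depend on their choice.\<close>

definition second_kind ::
  "(real \<times> real) set \<Rightarrow> (real \<times> real \<Rightarrow> real^3) \<Rightarrow> (real \<times> real \<Rightarrow> real^3) \<Rightarrow> real \<times> real \<Rightarrow> bool" where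
  "second_kind \<Sigma> f \<nu> p \<longleftrightarrow> nondegenerate_singular_point \<Sigma> f \<nu> p \<and>
     (\<exists>\<gamma> W \<eta>. singular_curve \<Sigma> f p \<gamma> \<and> open W \<and> p \<in> W \<and> W \<subseteq> \<Sigma> \<and> null_vector_field W f \<eta> \<and>
        \<not> lin_indep_pair (vector_derivative \<gamma> (at 0)) (\<eta> p))"


section \<open>Fundamental forms and curvatures\<close>

definition first_form :: "(real \<times> real \<Rightarrow> real^3) \<Rightarrow> real \<times> real \<Rightarrow> real^2^2" where
  "first_form f q = vector [vector [du f q \<bullet> du f q, du f q \<bullet> dv f q],
                            vector [dv f q \<bullet> du f q, dv f q \<bullet> dv f q]]"

definition second_form ::
  "(real \<times> real \<Rightarrow> real^3) \<Rightarrow> (real \<times> real \<Rightarrow> real^3) \<Rightarrow> real \<times> real \<Rightarrow> real^2^2" where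
  "second_form f \<nu> q = vector [vector [- (du f q \<bullet> du \<nu> q), - (du f q \<bullet> dv \<nu> q)],
                               vector [- (dv f q \<bullet> du \<nu> q), - (dv f q \<bullet> dv \<nu> q)]]"

definition gaussian_curvature ::
  "(real \<times> real \<Rightarrow> real^3) \<Rightarrow> (real \<times> real \<Rightarrow> real^3) \<Rightarrow> real \<times> real \<Rightarrow> real" where
  "gaussian_curvature f \<nu> q = det (second_form f \<nu> q) / det (first_form f q)"

definition principal_curvatures ::
  "(real \<times> real \<Rightarrow> real^3) \<Rightarrow> (real \<times> real \<Rightarrow> real^3) \<Rightarrow> real \<times> real \<Rightarrow> real set" where
  "principal_curvatures f \<nu> q = {k. det (second_form f \<nu> q - k *\<^sub>R first_form f q) = 0}"


section \<open>Local coordinates and rational continuity\<close>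

text \<open>A coordinate system centered at \<open>p\<close> is represented by its inverse \<open>\<phi>\<close>, a diffeomorphism from
  an open neighbourhood \<open>U\<close> of the origin in the \<open>(u,v)\<close>-plane onto an open subset of \<open>\<Sigma>\<close>. A map
  \<open>f\<close> on \<open>\<Sigma>\<close> reads \<open>f \<circ> \<phi>\<close> in these coordinates.\<close>

definition local_coords ::
  "(real \<times> real) set \<Rightarrow> real \<times> real \<Rightarrow> (real \<times> real) set \<Rightarrow> (real \<times> real \<Rightarrow> real \<times> real) \<Rightarrow> bool" where
  "local_coords \<Sigma> p U \<phi> \<longleftrightarrow> open U \<and> (0, 0) \<in> U \<and> \<phi> (0, 0) = p \<and> \<phi> ` U \<subseteq> \<Sigma> \<and> open (\<phi> ` U) \<and>
     inj_on \<phi> U \<and> smooth_on U \<phi> \<and> smooth_on (\<phi> ` U) (inv_into U \<phi>)"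

text \<open>\<open>F\<close> is a function on \<open>\<Sigma> - S\<close>. Functions on \<open>[0,\<epsilon>) \<times> \<real>/2\<pi>\<int>\<close> are represented by
  functions that are \<open>2\<pi>\<close>-periodic in the second variable.\<close>

definition rational_repr ::
  "(real \<times> real) set \<Rightarrow> (real \<times> real) set \<Rightarrow> (real \<times> real \<Rightarrow> real) \<Rightarrow> real \<times> real \<Rightarrow>
   (real \<Rightarrow> real \<Rightarrow> real) \<Rightarrow> (real \<Rightarrow> real \<Rightarrow> real) \<Rightarrow> bool" where
  "rational_repr \<Sigma> S F p a b \<longleftrightarrow>
     (\<exists>W. open W \<and> p \<in> W \<and> W \<subseteq> \<Sigma> \<and> continuous_on (W - S) F) \<and>
     (\<exists>U \<phi> \<epsilon>. local_coords \<Sigma> p U \<phi> \<and> \<epsilon> > 0 \<and>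
        (\<forall>r \<theta>. a r (\<theta> + 2 * pi) = a r \<theta> \<and> b r (\<theta> + 2 * pi) = b r \<theta>) \<and>
        continuous_on ({0..<\<epsilon>} \<times> UNIV) (\<lambda>(r, \<theta>). a r \<theta>) \<and>
        continuous_on ({0..<\<epsilon>} \<times> UNIV) (\<lambda>(r, \<theta>). b r \<theta>) \<and>
        finite {\<theta> \<in> {0..<2 * pi}. b 0 \<theta> = 0} \<and>
        (\<forall>r \<theta>. 0 < r \<and> r < \<epsilon> \<and> b r \<theta> \<noteq> 0 \<and>
           (r * cos \<theta>, r * sin \<theta>) \<in> U \<and> \<phi> (r * cos \<theta>, r * sin \<theta>) \<notin> S \<longrightarrow>
           F (\<phi> (r * cos \<theta>, r * sin \<theta>)) = a r \<theta> / b r \<theta>))"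

definition rationally_bounded ::
  "(real \<times> real) set \<Rightarrow> (real \<times> real) set \<Rightarrow> (real \<times> real \<Rightarrow> real) \<Rightarrow> real \<times> real \<Rightarrow> bool" where
  "rationally_bounded \<Sigma> S F p \<longleftrightarrow> (\<exists>a b. rational_repr \<Sigma> S F p a b)"

definition rationally_continuous ::
  "(real \<times> real) set \<Rightarrow> (real \<times> real) set \<Rightarrow> (real \<times> real \<Rightarrow> real) \<Rightarrow> real \<times> real \<Rightarrow> bool" where
  "rationally_continuous \<Sigma> S F p \<longleftrightarrow>
     (\<exists>a b. rational_repr \<Sigma> S F p a b \<and> (\<exists>c. \<forall>\<theta>. b 0 \<theta> \<noteq> 0 \<longrightarrow> a 0 \<theta> / b 0 \<theta> = c))"


section \<open>Strongly adapted coordinates and sub-parabolic points\<close>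

definition adapted ::
  "(real \<times> real) set \<Rightarrow> (real \<times> real \<Rightarrow> real^3) \<Rightarrow> bool" where
  "adapted U g \<longleftrightarrow> du g (0, 0) = 0 \<and> singular_set U g = {q \<in> U. snd q = 0} \<and> norm (dv g (0, 0)) = 1"

definition strongly_adapted ::
  "(real \<times> real) set \<Rightarrow> (real \<times> real \<Rightarrow> real^3) \<Rightarrow> bool" where
  "strongly_adapted U g \<longleftrightarrow> adapted U g \<and> dv (du g) (0, 0) \<bullet> dv g (0, 0) = 0"

definition adapted_frame ::
  "(real \<times> real) set \<Rightarrow> (real \<times> real \<Rightarrow> real^3) \<Rightarrow> (real \<Rightarrow> real) \<Rightarrow> (real \<times> real \<Rightarrow> real^3) \<Rightarrow> bool" where
  "adapted_frame U g e h \<longleftrightarrow> smooth_on (fst ` U) e \<and> e 0 = 0 \<and>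
     null_vector_field U g (\<lambda>(u, v). (1, e u)) \<and>
     smooth_on U h \<and> (\<forall>(u, v)\<in>U. du g (u, v) + e u *\<^sub>R dv g (u, v) = v *\<^sub>R h (u, v)) \<and>
     (\<forall>q\<in>U. lin_indep_pair (h q) (dv g q))"

definition adapted_normal ::
  "(real \<times> real \<Rightarrow> real^3) \<Rightarrow> (real \<times> real \<Rightarrow> real^3) \<Rightarrow> real \<times> real \<Rightarrow> real^3" where
  "adapted_normal g h q = cross3 (h q) (dv g q) /\<^sub>R norm (cross3 (h q) (dv g q))"

text \<open>\<open>\<kappa>\<close> is the bounded principal curvature, \<open>\<kappa>t\<close> the unbounded one, relevant
  only off the singular set, and \<open>\<kappa>h\<close> the smooth extension of \<open>\<kappa>t\<close> times the signed area density.
  Off the singular set the characteristic equation is quadratic with real roots, so the set equation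
  determines \<open>\<kappa>t\<close> as the other root, also when the two roots coincide.\<close>

definition principal_curvature_data ::
  "(real \<times> real) set \<Rightarrow> (real \<times> real \<Rightarrow> real^3) \<Rightarrow> (real \<times> real \<Rightarrow> real^3) \<Rightarrow>
   (real \<times> real \<Rightarrow> real) \<Rightarrow> (real \<times> real \<Rightarrow> real) \<Rightarrow> (real \<times> real \<Rightarrow> real) \<Rightarrow> bool" where
  "principal_curvature_data U g \<nu> \<kappa> \<kappa>t \<kappa>h \<longleftrightarrow>
     (\<forall>q \<in> U - singular_set U g. principal_curvatures g \<nu> q = {\<kappa> q, \<kappa>t q}) \<and>
     smooth_on U \<kappa> \<and> bounded (\<kappa> ` U) \<and>
     (\<forall>W. open W \<and> (0, 0) \<in> W \<longrightarrow> \<not> bounded (\<kappa>t ` (W \<inter> U - singular_set U g))) \<and>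
     smooth_on U \<kappa>h \<and>
     (\<forall>q \<in> U - singular_set U g. \<kappa>h q = signed_area_density g \<nu> q * \<kappa>t q)"

definition unbounded_principal_vector ::
  "(real \<times> real \<Rightarrow> real^3) \<Rightarrow> (real \<Rightarrow> real) \<Rightarrow> (real \<times> real \<Rightarrow> real^3) \<Rightarrow>
   (real \<times> real \<Rightarrow> real) \<Rightarrow> real \<times> real \<Rightarrow> real \<times> real" where
  "unbounded_principal_vector g e h \<kappa>h q =
     (let \<nu> = adapted_normal g h;
          F = h q \<bullet> dv g q;
          G = dv g q \<bullet> dv g q;
          M = - (h q \<bullet> dv \<nu> q);
          N = - (dv g q \<bullet> dv \<nu> q);
          d = signed_area_density g \<nu> q;
          V1 = d * N - \<kappa>h q * G
      in (V1, - snd q * (d * M - \<kappa>h q * F) + e (fst q) * V1))"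

text \<open>The notion does not depend on the choice of the strongly adapted coordinates and of the data
  attached to them; such coordinates and data exist at every singular point of the second kind of a
  front. It is required here for every choice.\<close>

definition sub_parabolic ::
  "(real \<times> real) set \<Rightarrow> (real \<times> real \<Rightarrow> real^3) \<Rightarrow> real \<times> real \<Rightarrow> bool" where
  "sub_parabolic \<Sigma> f p \<longleftrightarrow>
     (\<forall>U \<phi> e h \<kappa> \<kappa>t \<kappa>h.
        local_coords \<Sigma> p U \<phi> \<longrightarrow> strongly_adapted U (f \<circ> \<phi>) \<longrightarrow> adapted_frame U (f \<circ> \<phi>) e h \<longrightarrow>
        principal_curvature_data U (f \<circ> \<phi>) (adapted_normal (f \<circ> \<phi>) h) \<kappa> \<kappa>t \<kappa>h \<longrightarrow>
        frechet_derivative \<kappa> (at (0, 0)) (unbounded_principal_vector (f \<circ> \<phi>) e h \<kappa>h (0, 0)) = 0)"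

end

theory Submission
  imports Defs
begin

text \<open>With \<open>\<delta> = |h \<times> f\<^sub>v|\<close> one has \<open>\<lambda> = v \<delta>\<close>, so \<open>K = \<kappa> \<kappa>\<^sub>t\<close> gives \<open>v \<delta> K = \<kappa> \<kappa>\<^sub>h\<close> off the singular
  set, where \<open>\<kappa>\<^sub>t\<close> is the unbounded curvature and \<open>\<kappa>\<^sub>h = \<lambda> \<kappa>\<^sub>t\<close>. The principal vector at \<open>p\<close> is
  \<open>(- \<kappa>\<^sub>h(p), 0)\<close>, so the claim is \<open>\<kappa>\<^sub>h(p) \<kappa>\<^sub>u(p) = 0\<close>. Let \<open>m\<close> be the transition map from the
  coordinates used for rational continuity, and \<open>w = dm(cos \<theta>, sin \<theta>)\<close>. Since \<open>K\<close> has the limit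
  \<open>c\<close> along all but finitely many rays, the relation at order \<open>0\<close> in the radius yields
  \<open>\<kappa>(p) \<kappa>\<^sub>h(p) = 0\<close>, and if \<open>\<kappa>(p) = 0\<close>, at order \<open>1\<close>, \<open>c \<delta>(p) w\<^sub>2 = \<kappa>\<^sub>h(p) d\<kappa>(w)\<close>. This is linear in \<open>w\<close> and holds
  in infinitely many directions, hence also for \<open>w = (1, 0)\<close>.\<close>

section \<open>Differentiability and partial derivatives of smooth maps\<close>

lemma smooth_on_differentiable:
  assumes "smooth_on S g" "x \<in> S"
  shows "g differentiable (at x)"
proof -
  have "Ck_on (Suc 0) S g" using assms(1) unfolding smooth_on_def by blast
  then show ?thesis using assms(2) by simp
qed

lemma smooth_on_derivative_differentiable:
  assumes "smooth_on S g" "x \<in> S"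
  shows "(\<lambda>x. frechet_derivative g (at x) X) differentiable (at x)"
proof -
  have "Ck_on (Suc (Suc 0)) S g" using assms(1) unfolding smooth_on_def by blast
  then show ?thesis using assms(2) by simp
qed

lemma frechet_derivative_pair:
  assumes "f differentiable (at x)"
  shows "frechet_derivative f (at x) X = fst X *\<^sub>R du f x + snd X *\<^sub>R dv f x"
proof -
  interpret linear "frechet_derivative f (at x)"
    using assms by (rule linear_frechet_derivative)
  have "frechet_derivative f (at x) (fst X *\<^sub>R (1, 0) + snd X *\<^sub>R (0, 1)) = fst X *\<^sub>R du f x + snd X *\<^sub>R dv f x"
    unfolding du_def dv_def add scale ..
  then show ?thesis by simp
qed

lemma du_compose:
  assumes "\<phi> differentiable (at q)" "f differentiable (at (\<phi> q))"
  shows "du (f \<circ> \<phi>) q = fst (du \<phi> q) *\<^sub>R du f (\<phi> q) + snd (du \<phi> q) *\<^sub>R dv f (\<phi> q)"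
  by (metis du_def comp_apply frechet_derivative_compose[OF assms] frechet_derivative_pair[OF assms(2)])

lemma dv_compose:
  assumes "\<phi> differentiable (at q)" "f differentiable (at (\<phi> q))"
  shows "dv (f \<circ> \<phi>) q = fst (dv \<phi> q) *\<^sub>R du f (\<phi> q) + snd (dv \<phi> q) *\<^sub>R dv f (\<phi> q)"
  by (metis dv_def comp_apply frechet_derivative_compose[OF assms] frechet_derivative_pair[OF assms(2)])

section \<open>Gaussian curvature under changes of coordinates and of the normal\<close>

lemma det_first_form:
  "det (first_form f q) = (du f q \<bullet> du f q) * (dv f q \<bullet> dv f q) - (du f q \<bullet> dv f q)\<^sup>2"
  unfolding first_form_def det_2 by (simp add: inner_commute power2_eq_square)

lemma det_second_form:
  "det (second_form f \<nu> q) = (du f q \<bullet> du \<nu> q) * (dv f q \<bullet> dv \<nu> q) - (du f q \<bullet> dv \<nu> q) * (dv f q \<bullet> du \<nu> q)"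
  unfolding second_form_def det_2 by simp

text \<open>The matrix of the form changes by congruence with the Jacobian matrix of
  \<open>\<phi>\<close>, so its determinant acquires the square of the Jacobian determinant. The
  second fundamental form obeys the same rule.\<close>

lemma det_first_form_compose:
  assumes "\<phi> differentiable (at q)" "f differentiable (at (\<phi> q))"
  shows "det (first_form (f \<circ> \<phi>) q) =
    (fst (du \<phi> q) * snd (dv \<phi> q) - snd (du \<phi> q) * fst (dv \<phi> q))\<^sup>2 * det (first_form f (\<phi> q))"
  unfolding det_first_form du_compose[OF assms] dv_compose[OF assms]
  by (simp add: inner_add_left inner_add_right inner_commute[of "dv f (\<phi> q)" "du f (\<phi> q)"]
      power2_eq_square algebra_simps)

lemma det_second_form_compose:
  assumes "\<phi> differentiable (at q)" "f differentiable (at (\<phi> q))" "\<nu> differentiable (at (\<phi> q))"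
  shows "det (second_form (f \<circ> \<phi>) (\<nu> \<circ> \<phi>) q) =
    (fst (du \<phi> q) * snd (dv \<phi> q) - snd (du \<phi> q) * fst (dv \<phi> q))\<^sup>2 * det (second_form f \<nu> (\<phi> q))"
  unfolding det_second_form du_compose[OF assms(1,2)] dv_compose[OF assms(1,2)]
    du_compose[OF assms(1,3)] dv_compose[OF assms(1,3)]
  by (simp add: inner_add_left inner_add_right power2_eq_square algebra_simps)

text \<open>Both determinants carry the same squared Jacobian factor, which cancels. The last
  assumption makes this factor nonzero.\<close>

lemma gaussian_curvature_compose:
  assumes "\<phi> differentiable (at q)" "f differentiable (at (\<phi> q))" "\<nu> differentiable (at (\<phi> q))"
    and "det (first_form (f \<circ> \<phi>) q) \<noteq> 0"
  shows "gaussian_curvature (f \<circ> \<phi>) (\<nu> \<circ> \<phi>) q = gaussian_curvature f \<nu> (\<phi> q)"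
  using assms(4) det_first_form_compose[OF assms(1,2)] det_second_form_compose[OF assms(1-3)]
  unfolding gaussian_curvature_def by simp

text \<open>The derivative of \<open>s\<close> contributes only multiples of \<open>N q\<close>,
  which are orthogonal to both tangent vectors. Hence the second form at \<open>q\<close> is merely
  multiplied by \<open>s q\<close>, and its determinant by \<open>(s q)\<^sup>2 = 1\<close>. This
  allows the given normal to be exchanged for the adapted one.\<close>

lemma gaussian_curvature_rescale_normal:
  assumes "open T" "q \<in> T" "\<And>x. x \<in> T \<Longrightarrow> n x = s x *\<^sub>R N x"
    and "s differentiable (at q)" "N differentiable (at q)" "(s q)\<^sup>2 = (1::real)"
    and "du g q \<bullet> N q = 0" "dv g q \<bullet> N q = 0"
  shows "gaussian_curvature g n q = gaussian_curvature g N q"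
proof -
  have "((\<lambda>x. s x *\<^sub>R N x) has_derivative
      (\<lambda>X. s q *\<^sub>R frechet_derivative N (at q) X + frechet_derivative s (at q) X *\<^sub>R N q)) (at q)"
    by (intro has_derivative_scaleR) (use assms frechet_derivative_works in blast)+
  then have "(n has_derivative
      (\<lambda>X. s q *\<^sub>R frechet_derivative N (at q) X + frechet_derivative s (at q) X *\<^sub>R N q)) (at q)"
    by (rule has_derivative_transform_within_open[OF _ assms(1,2)]) (simp add: assms(3))
  then have D: "frechet_derivative n (at q) =
      (\<lambda>X. s q *\<^sub>R frechet_derivative N (at q) X + frechet_derivative s (at q) X *\<^sub>R N q)"
    by (rule frechet_derivative_at[symmetric])
  have "det (second_form g n q) = (s q)\<^sup>2 * det (second_form g N q)"
    unfolding det_second_form using assms(7,8)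
    by (simp add: du_def dv_def D inner_add_right power2_eq_square algebra_simps)
  then show ?thesis using assms(6) by (simp add: gaussian_curvature_def)
qed

text \<open>If the two listed curvatures coincide, the second root of the characteristic quadratic
  must coincide with them as well, so Vieta's formula still applies.\<close>

lemma gaussian_curvature_eq_prod:
  assumes "principal_curvatures g n q = {k1, k2}" and D: "det (first_form g q) \<noteq> 0"
  shows "gaussian_curvature g n q = k1 * k2"
proof -
  define D where "D = det (first_form g q)"
  define C where "C = det (second_form g n q)"
  \<comment> \<open>The polarization of \<open>det\<close>: the linear coefficient of the
    characteristic quadratic up to sign.\<close>
  define B where "B = first_form g q $ 1 $ 1 * second_form g n q $ 2 $ 2
    + first_form g q $ 2 $ 2 * second_form g n q $ 1 $ 1
    - first_form g q $ 1 $ 2 * second_form g n q $ 2 $ 1 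
    - first_form g q $ 2 $ 1 * second_form g n q $ 1 $ 2"
  have char: "det (second_form g n q - k *\<^sub>R first_form g q) = D * k\<^sup>2 - B * k + C" for k
    unfolding D_def C_def B_def det_2 by (simp add: algebra_simps power2_eq_square)
  have roots: "D * k\<^sup>2 - B * k + C = 0 \<longleftrightarrow> k = k1 \<or> k = k2" for k
    using assms(1) char unfolding principal_curvatures_def by auto
  have D0: "D \<noteq> 0" using D D_def by simp
  have r1: "D * k1\<^sup>2 - B * k1 + C = 0" and r2: "D * k2\<^sup>2 - B * k2 + C = 0" using roots by auto
  have "D * (B / D - k1)\<^sup>2 - B * (B / D - k1) + C = D * k1\<^sup>2 - B * k1 + C"
    using D0 by (simp add: field_simps power2_eq_square)
  then have other: "B / D - k1 = k1 \<or> B / D - k1 = k2" using r1 roots by auto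
  have "B = D * (k1 + k2)"
  proof (cases "k1 = k2")
    case True
    then show ?thesis using other D0 by (simp add: field_simps)
  next
    case False
    have "(k1 - k2) * (D * (k1 + k2) - B) = 0" using r1 r2 by algebra
    then show ?thesis using False by simp
  qed
  then have "C = D * (k1 * k2)" using r1 by algebra
  then show ?thesis using D0 by (simp add: gaussian_curvature_def C_def D_def)
qed

section \<open>Linear functionals and independent vectors\<close>

text \<open>The interval \<open>{0..<pi}\<close> meets each line through the origin in exactly one
  direction, so two distinct zeros already give two independent directions, on which a linear
  functional of the plane is determined.\<close>

lemma trig_functional_eq_0:
  assumes "infinite {\<theta> \<in> {0..<pi}. \<alpha> * cos \<theta> + \<beta> * sin \<theta> = 0}"
  shows "\<alpha> = 0 \<and> \<beta> = 0"
proof -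
  let ?Z = "{\<theta> \<in> {0..<pi}. \<alpha> * cos \<theta> + \<beta> * sin \<theta> = 0}"
  obtain s where s: "s \<in> ?Z" using infinite_imp_nonempty[OF assms] by blast
  have "infinite (?Z - {s})" using assms by simp
  then obtain t where t: "t \<in> ?Z" "t \<noteq> s" using infinite_imp_nonempty by blast
  \<comment> \<open>This is the determinant of the linear system for \<alpha> and \<beta>; the two
    angles differ by less than \<open>pi\<close>.\<close>
  have "sin (t - s) \<noteq> 0"
  proof (cases "s < t")
    case True
    then have "sin (t - s) > 0" using s t by (intro sin_gt_zero) auto
    then show ?thesis by simp
  next
    case False
    then have "sin (s - t) > 0" using s t by (intro sin_gt_zero) auto
    then show ?thesis by (metis less_irrefl minus_diff_eq neg_equal_0_iff_equal sin_minus)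
  qed
  then have d: "sin t * cos s - cos t * sin s \<noteq> 0" by (simp add: sin_diff)
  have "\<alpha> * (sin t * cos s - cos t * sin s) = 0" "\<beta> * (sin t * cos s - cos t * sin s) = 0"
    using s t by (simp, algebra)+
  then show ?thesis using d by simp
qed

text \<open>A vanishing cross product means collinearity. It makes the adapted normal a genuine unit
  vector.\<close>

lemma frame_cross_nonzero:
  assumes "lin_indep_pair x y" shows "cross3 x y \<noteq> 0"
proof
  assume "cross3 x y = 0"
  then have "collinear {0, x, y}" by (simp add: cross_eq_0)
  then obtain c where "x = 0 \<or> y = 0 \<or> y = c *\<^sub>R x" by (auto simp: collinear_lemma)
  moreover have "x \<noteq> 0" "y \<noteq> 0" "x \<noteq> y" "independent {x, y}"
    using assms unfolding lin_indep_pair_def by (auto simp: dependent_zero)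
  moreover have "y \<in> span {x}" if "y = c *\<^sub>R x" using that by (simp add: span_base span_scale)
  ultimately show False by (metis independent_insert insert_commute singletonD)
qed


lemma linear_functional_pair:
  fixes L :: "real \<times> real \<Rightarrow> real"
  assumes "linear L"
  shows "L (x, y) = L (1, 0) * x + L (0, 1) * y"
proof -
  have "L (x *\<^sub>R (1, 0) + y *\<^sub>R (0, 1)) = x *\<^sub>R L (1, 0) + y *\<^sub>R L (0, 1)"
    using assms by (simp only: linear_add linear_scale)
  then show ?thesis by (simp add: mult.commute)
qed

section \<open>Asymptotics along rays\<close>

lemma ray_tendsto: "((\<lambda>r. (r * cos \<theta>, r * sin \<theta>)) \<longlongrightarrow> (0, 0)) (at_right 0)"
  by (auto intro!: tendsto_eq_intros)

text \<open>The chain rule along the ray, whose velocity at the origin is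
  \<open>(cos \<theta>, sin \<theta>)\<close>.\<close>

lemma ray_quotient_tendsto:
  fixes g :: "real \<times> real \<Rightarrow> real"
  assumes "(g has_derivative D) (at (0, 0))"
  shows "((\<lambda>r. (g (r * cos \<theta>, r * sin \<theta>) - g (0, 0)) / r) \<longlongrightarrow> D (cos \<theta>, sin \<theta>)) (at_right 0)"
proof -
  have lin: "linear D" using assms by (rule has_derivative_linear)
  have "((\<lambda>r. (r * cos \<theta>, r * sin \<theta>)) has_derivative (\<lambda>r. (r * cos \<theta>, r * sin \<theta>))) (at 0)"
    by (auto intro!: derivative_eq_intros)
  from has_derivative_compose[OF this, of g D] assms
  have "((\<lambda>r. g (r * cos \<theta>, r * sin \<theta>)) has_derivative (\<lambda>r. D (r * cos \<theta>, r * sin \<theta>))) (at 0)"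
    by simp
  moreover have "D (r * cos \<theta>, r * sin \<theta>) = D (cos \<theta>, sin \<theta>) * r" for r
    using linear_scale[OF lin, of r "(cos \<theta>, sin \<theta>)"] by simp
  ultimately have "((\<lambda>r. g (r * cos \<theta>, r * sin \<theta>)) has_field_derivative D (cos \<theta>, sin \<theta>)) (at 0)"
    by (simp add: has_field_derivative_def)
  then have "((\<lambda>r. (g (r * cos \<theta>, r * sin \<theta>) - g (0, 0)) / r) \<longlongrightarrow> D (cos \<theta>, sin \<theta>)) (at 0)"
    unfolding DERIV_def by simp
  then show ?thesis by (rule tendsto_mono[rotated]) (simp add: at_le)
qed

lemma polar_slice_tendsto:
  fixes a :: "real \<Rightarrow> real \<Rightarrow> real"
  assumes "continuous_on ({0..<\<epsilon>} \<times> UNIV) (\<lambda>(r, \<theta>). a r \<theta>)" "\<epsilon> > 0"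
  shows "((\<lambda>r. a r \<theta>) \<longlongrightarrow> a 0 \<theta>) (at_right 0)"
proof -
  have "continuous_on {0..<\<epsilon>} (\<lambda>r. (r, \<theta>))" by (intro continuous_intros)
  from continuous_on_compose2[OF assms(1) this] have "continuous_on {0..<\<epsilon>} (\<lambda>r. a r \<theta>)" by auto
  then have "((\<lambda>r. a r \<theta>) \<longlongrightarrow> a 0 \<theta>) (at 0 within {0..<\<epsilon>})"
    unfolding continuous_on_def by (rule bspec) (use assms(2) in simp)
  \<comment> \<open>The value at radius 0 is part of the continuity assumption, so the one-sided
    limit is \<open>a 0 \<theta>\<close>.\<close>
  moreover have "at 0 within {0..<\<epsilon>} = at_right 0"
    using assms(2) by (intro at_within_nhd[of 0 "{-\<epsilon><..<\<epsilon>}"]) auto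
  ultimately show ?thesis by simp
qed

text \<open>Here \<open>m\<close> stands for the transition map and \<open>a r / b r\<close> for the
  Gaussian curvature on one ray. The second coordinate of \<open>m\<close> vanishes to first order
  in \<open>r\<close>, so the two conclusions compare both sides of the relation at orders 0 and
  1.\<close>

lemma ray_expansion:
  fixes k kh \<delta> :: "real \<times> real \<Rightarrow> real" and m :: "real \<times> real \<Rightarrow> real \<times> real"
  assumes m: "(m has_derivative A) (at (0, 0))" "m (0, 0) = (0, 0)"
    and k: "(k has_derivative Dk) (at (0, 0))"
    and kh: "isCont kh (0, 0)" and \<delta>: "isCont \<delta> (0, 0)"
    and a: "((\<lambda>r. a r) \<longlongrightarrow> a 0) (at_right 0)" and b: "((\<lambda>r. b r) \<longlongrightarrow> b 0) (at_right 0)"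
    and ev: "\<forall>\<^sub>F r in at_right 0. b r \<noteq> 0 \<longrightarrow> snd (m (r * cos \<theta>, r * sin \<theta>)) \<noteq> 0 \<longrightarrow>
      snd (m (r * cos \<theta>, r * sin \<theta>)) * \<delta> (m (r * cos \<theta>, r * sin \<theta>)) * (a r / b r) =
      k (m (r * cos \<theta>, r * sin \<theta>)) * kh (m (r * cos \<theta>, r * sin \<theta>))"
    and b0: "b 0 \<noteq> 0" and transversal: "snd (A (cos \<theta>, sin \<theta>)) \<noteq> 0"
  shows "k (0, 0) * kh (0, 0) = 0"
    and "k (0, 0) = 0 \<Longrightarrow>
      snd (A (cos \<theta>, sin \<theta>)) * \<delta> (0, 0) * (a 0 / b 0) = Dk (A (cos \<theta>, sin \<theta>)) * kh (0, 0)"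
proof -
  define q where "q r = m (r * cos \<theta>, r * sin \<theta>)" for r
  have "isCont m (0, 0)" using m(1) by (rule has_derivative_continuous)
  then have q: "(q \<longlongrightarrow> (0, 0)) (at_right 0)"
    using isCont_tendsto_compose[OF _ ray_tendsto[of \<theta>], of m] m(2) by (simp add: q_def[abs_def])
  have v: "((\<lambda>r. snd (q r)) \<longlongrightarrow> 0) (at_right 0)" using tendsto_snd[OF q] by simp
  have "((\<lambda>x. snd (m x)) has_derivative (\<lambda>X. snd (A X))) (at (0, 0))"
    using m(1) by (rule has_derivative_snd)
  from ray_quotient_tendsto[OF this]
  have vr: "((\<lambda>r. snd (q r) / r) \<longlongrightarrow> snd (A (cos \<theta>, sin \<theta>))) (at_right 0)"
    by (simp add: q_def m(2))
  have "((\<lambda>x. k (m x)) has_derivative (\<lambda>X. Dk (A X))) (at (0, 0))"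
    using has_derivative_compose[OF m(1), of k Dk] k m(2) by simp
  from ray_quotient_tendsto[OF this]
  have kr: "((\<lambda>r. (k (q r) - k (0, 0)) / r) \<longlongrightarrow> Dk (A (cos \<theta>, sin \<theta>))) (at_right 0)"
    by (simp add: q_def m(2))
  have \<delta>q: "((\<lambda>r. \<delta> (q r)) \<longlongrightarrow> \<delta> (0, 0)) (at_right 0)"
    and khq: "((\<lambda>r. kh (q r)) \<longlongrightarrow> kh (0, 0)) (at_right 0)"
    and kq: "((\<lambda>r. k (q r)) \<longlongrightarrow> k (0, 0)) (at_right 0)"
    using isCont_tendsto_compose[OF _ q] \<delta> kh has_derivative_continuous[OF k] by auto
  have ab: "((\<lambda>r. a r / b r) \<longlongrightarrow> a 0 / b 0) (at_right 0)"
    using a b b0 by (rule tendsto_divide)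
  \<comment> \<open>Both premises of the relation in \<open>ev\<close> hold for small
    \<open>r\<close>: \<open>b 0\<close> is nonzero, and by transversality the ray leaves the axis
    to first order.\<close>
  have "\<forall>\<^sub>F r in at_right 0. b r \<noteq> 0" using tendsto_imp_eventually_ne[OF b b0] .
  moreover have "\<forall>\<^sub>F r in at_right 0. snd (q r) / r \<noteq> 0"
    using tendsto_imp_eventually_ne[OF vr transversal] .
  moreover have "\<forall>\<^sub>F r in at_right 0. (0::real) < r" by (rule eventually_at_right_less)
  ultimately have eq: "\<forall>\<^sub>F r in at_right 0. 0 < r \<and>
      snd (q r) * \<delta> (q r) * (a r / b r) = k (q r) * kh (q r)"
    using ev unfolding q_def[symmetric] by eventually_elim auto
  \<comment> \<open>Order 0: the quotient stays bounded while its factor \<open>snd (q r)\<close>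
    tends to 0.\<close>
  have "((\<lambda>r. snd (q r) * \<delta> (q r) * (a r / b r)) \<longlongrightarrow> 0 * \<delta> (0, 0) * (a 0 / b 0)) (at_right 0)"
    by (intro tendsto_mult v \<delta>q ab)
  then have "((\<lambda>r. k (q r) * kh (q r)) \<longlongrightarrow> 0 * \<delta> (0, 0) * (a 0 / b 0)) (at_right 0)"
    by (rule Lim_transform_eventually) (rule eventually_mono[OF eq], simp)
  from tendsto_unique[OF _ tendsto_mult[OF kq khq] this]
  show "k (0, 0) * kh (0, 0) = 0" by simp
  assume k0: "k (0, 0) = 0"
  \<comment> \<open>Order 1: divide the relation by \<open>r\<close>. As
    \<open>k (0, 0) = 0\<close>, the right side becomes a difference quotient of \<open>k\<close>
    times \<open>kh\<close>.\<close>
  have "((\<lambda>r. (snd (q r) / r) * \<delta> (q r) * (a r / b r)) \<longlongrightarrow>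
      snd (A (cos \<theta>, sin \<theta>)) * \<delta> (0, 0) * (a 0 / b 0)) (at_right 0)"
    by (intro tendsto_mult vr \<delta>q ab)
  then have "((\<lambda>r. (k (q r) - k (0, 0)) / r * kh (q r)) \<longlongrightarrow>
      snd (A (cos \<theta>, sin \<theta>)) * \<delta> (0, 0) * (a 0 / b 0)) (at_right 0)"
    by (rule Lim_transform_eventually) (rule eventually_mono[OF eq], simp add: k0 divide_simps mult.commute)
  from tendsto_unique[OF _ this tendsto_mult[OF kr khq]]
  show "snd (A (cos \<theta>, sin \<theta>)) * \<delta> (0, 0) * (a 0 / b 0) = Dk (A (cos \<theta>, sin \<theta>)) * kh (0, 0)"
    by simp
qed

text \<open>The limit \<open>c\<close> is the same for all admissible directions, which makes the
  first-order relation linear in the direction. It can then be carried over to the direction that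
  \<open>A\<close> maps to \<open>(1, 0)\<close>, even if that one is excluded by
  \<open>transversal\<close>.\<close>

lemma rational_limit_imp_derivative_0:
  fixes k kh \<delta> :: "real \<times> real \<Rightarrow> real" and m :: "real \<times> real \<Rightarrow> real \<times> real"
  assumes m: "(m has_derivative A) (at (0, 0))" "m (0, 0) = (0, 0)" "surj A"
    and k: "(k has_derivative Dk) (at (0, 0))"
    and kh: "isCont kh (0, 0)" and \<delta>: "isCont \<delta> (0, 0)"
    and \<epsilon>: "\<epsilon> > 0"
    and a: "continuous_on ({0..<\<epsilon>} \<times> UNIV) (\<lambda>(r, \<theta>). a r \<theta>)"
    and b: "continuous_on ({0..<\<epsilon>} \<times> UNIV) (\<lambda>(r, \<theta>). b r \<theta>)"
    and fin: "finite {\<theta> \<in> {0..<2 * pi}. b 0 \<theta> = 0}"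
    and ev: "\<And>\<theta>. \<forall>\<^sub>F r in at_right 0. b r \<theta> \<noteq> 0 \<longrightarrow> snd (m (r * cos \<theta>, r * sin \<theta>)) \<noteq> 0 \<longrightarrow>
      snd (m (r * cos \<theta>, r * sin \<theta>)) * \<delta> (m (r * cos \<theta>, r * sin \<theta>)) * (a r \<theta> / b r \<theta>) =
      k (m (r * cos \<theta>, r * sin \<theta>)) * kh (m (r * cos \<theta>, r * sin \<theta>))"
    and c: "\<And>\<theta>. b 0 \<theta> \<noteq> 0 \<Longrightarrow> a 0 \<theta> / b 0 \<theta> = c"
  shows "Dk (1, 0) * kh (0, 0) = 0"
proof (cases "kh (0, 0) = 0")
  case False
  note exp = ray_expansion[OF m(1,2) k kh \<delta> polar_slice_tendsto[OF a \<epsilon>] polar_slice_tendsto[OF b \<epsilon>] ev]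
  have linA: "linear A" and linDk: "linear Dk" using m k by (auto dest: has_derivative_linear)
  \<comment> \<open>Difference of the two sides of the first-order relation, with the quotient
    replaced by its common value \<open>c\<close>.\<close>
  define L where "L w = snd (A w) * \<delta> (0, 0) * c - Dk (A w) * kh (0, 0)" for w
  have linL: "linear L" and linS: "linear (\<lambda>w. snd (A w))"
    unfolding L_def by (rule linearI; simp add: linear_add[OF linA] linear_scale[OF linA]
      linear_add[OF linDk] linear_scale[OF linDk] algebra_simps)+
  let ?Z = "\<lambda>P. {\<theta> \<in> {0..<pi}. P (cos \<theta>, sin \<theta>) = 0}"
  let ?B = "{\<theta> \<in> {0..<2 * pi}. b 0 \<theta> = 0}"
  \<comment> \<open>Otherwise the image of \<open>A\<close> would lie in the horizontal axis,
    against surjectivity.\<close>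
  have finS: "finite (?Z (\<lambda>w. snd (A w)))"
  proof (rule ccontr)
    assume "infinite (?Z (\<lambda>w. snd (A w)))"
    then have "snd (A (1, 0)) = 0 \<and> snd (A (0, 1)) = 0"
      by (intro trig_functional_eq_0) (simp add: linear_functional_pair[OF linS, of "cos _" "sin _"])
    then have "snd (A w) = 0" for w
      using linear_functional_pair[OF linS, of "fst w" "snd w"] by simp
    moreover obtain w where "(0, 1) = A w" using m(3) by (rule surjE)
    ultimately have "snd (0 :: real, 1 :: real) = 0" by simp
    then show False by simp
  qed
  have inf: "infinite ({0..<pi} - ?Z (\<lambda>w. snd (A w)) - ?B)"
    using infinite_Ico[OF pi_gt_zero] by (intro Diff_infinite_finite finS fin)
  then obtain \<theta>0 where "\<theta>0 \<in> {0..<pi} - ?Z (\<lambda>w. snd (A w)) - ?B"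
    using infinite_imp_nonempty by blast
  then have "b 0 \<theta>0 \<noteq> 0" "snd (A (cos \<theta>0, sin \<theta>0)) \<noteq> 0" by auto
  from exp(1)[OF this] False have k0: "k (0, 0) = 0" by simp
  have "{0..<pi} - ?Z (\<lambda>w. snd (A w)) - ?B \<subseteq> ?Z L"
  proof
    fix \<theta> assume \<theta>: "\<theta> \<in> {0..<pi} - ?Z (\<lambda>w. snd (A w)) - ?B"
    then have "b 0 \<theta> \<noteq> 0" "snd (A (cos \<theta>, sin \<theta>)) \<noteq> 0" by auto
    from exp(2)[OF this k0] c[OF this(1)] \<theta> show "\<theta> \<in> ?Z L" by (simp add: L_def)
  qed
  with inf have "infinite (?Z L)" using finite_subset by blast
  then have "L (1, 0) = 0 \<and> L (0, 1) = 0"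
    by (intro trig_functional_eq_0) (simp add: linear_functional_pair[OF linL, of "cos _" "sin _"])
  then have L0: "L w = 0" for w using linear_functional_pair[OF linL, of "fst w" "snd w"] by simp
  \<comment> \<open>For this \<open>w\<close> the term with \<open>c\<close> drops out, since
    \<open>snd (A w) = 0\<close>.\<close>
  obtain w where "(1, 0) = A w" using m(3) by (rule surjE)
  then show ?thesis using L0[of w] unfolding L_def by (metis diff_0 mult_zero_left neg_equal_0_iff_equal snd_conv)
qed simp

section \<open>The curvature relation in adapted coordinates\<close>

text \<open>By the chain rule, the partial derivative of the composite is built from first
  derivatives of \<open>\<phi>\<close> and of \<open>f\<close>, each differentiable by smoothness.
  This is used for the adapted normal and for \<delta>.\<close>

lemma dv_compose_differentiable:
  fixes \<phi> :: "real \<times> real \<Rightarrow> real \<times> real"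
  assumes "open U" "smooth_on U \<phi>" "\<phi> ` U \<subseteq> \<Sigma>" "smooth_on \<Sigma> f" "q \<in> U"
  shows "dv (f \<circ> \<phi>) differentiable (at q)"
proof -
  have \<phi>: "\<phi> differentiable (at x)" if "x \<in> U" for x
    using smooth_on_differentiable[OF assms(2) that] .
  have f: "f differentiable (at (\<phi> x))" if "x \<in> U" for x
    using smooth_on_differentiable[OF assms(4)] assms(3) that by blast
  let ?R = "\<lambda>x. fst (dv \<phi> x) *\<^sub>R du f (\<phi> x) + snd (dv \<phi> x) *\<^sub>R dv f (\<phi> x)"
  have "dv \<phi> differentiable (at q)"
    unfolding dv_def by (rule smooth_on_derivative_differentiable[OF assms(2,5)])
  then obtain D where D: "(dv \<phi> has_derivative D) (at q)" unfolding differentiable_def ..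
  have "du f differentiable (at (\<phi> q))" "dv f differentiable (at (\<phi> q))"
    unfolding du_def dv_def using assms by (auto intro!: smooth_on_derivative_differentiable[OF assms(4)])
  then have "(\<lambda>x. du f (\<phi> x)) differentiable (at q)" "(\<lambda>x. dv f (\<phi> x)) differentiable (at q)"
    using \<phi>[OF assms(5)] differentiable_chain_at unfolding comp_def by blast+
  moreover have "(\<lambda>x. fst (dv \<phi> x)) differentiable (at q)" "(\<lambda>x. snd (dv \<phi> x)) differentiable (at q)"
    using has_derivative_fst[OF D] has_derivative_snd[OF D] unfolding differentiable_def by blast+
  ultimately have "?R differentiable (at q)" by (intro differentiable_add differentiable_scaleR)
  then obtain D' where "(?R has_derivative D') (at q)" unfolding differentiable_def ..
  then have "(dv (f \<circ> \<phi>) has_derivative D') (at q)"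
    by (rule has_derivative_transform_within_open[OF _ assms(1,5)]) (simp add: dv_compose[OF \<phi> f])
  then show ?thesis unfolding differentiable_def by blast
qed

lemma differentiable_cross3:
  assumes "f differentiable (at x)" "g differentiable (at x)"
  shows "(\<lambda>x. cross3 (f x) (g x)) differentiable (at x)"
proof -
  interpret bounded_bilinear cross3 using bilinear_cross by (simp add: bilinear_conv_bounded_bilinear)
  show ?thesis using assms FDERIV unfolding differentiable_def by blast
qed

text \<open>Off the axis the adapted normal agrees with \<open>\<nu> \<circ> \<phi>\<close> up to
  sign, so both give the same curvature, namely the product \<open>\<kappa> q * \<kappa>t q\<close>.
  Multiplying by the signed area density turns \<open>\<kappa>t q\<close> into
  \<open>\<kappa>h q\<close>.\<close>

lemma curvature_relation:
  fixes f \<nu> :: "real \<times> real \<Rightarrow> real^3"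
  assumes fr: "frontal_on \<Sigma> f \<nu>"
    and lc: "local_coords \<Sigma> p U \<phi>"
    and ad: "adapted U (f \<circ> \<phi>)"
    and af: "adapted_frame U (f \<circ> \<phi>) e h"
    and pc: "principal_curvature_data U (f \<circ> \<phi>) (adapted_normal (f \<circ> \<phi>) h) \<kappa> \<kappa>t \<kappa>h"
    and q: "q \<in> U" "snd q \<noteq> 0"
  shows "snd q * norm (cross3 (h q) (dv (f \<circ> \<phi>) q)) * gaussian_curvature f \<nu> (\<phi> q) = \<kappa> q * \<kappa>h q"
proof -
  define g where "g = f \<circ> \<phi>"
  define N where "N = \<nu> \<circ> \<phi>"
  define n where "n = adapted_normal g h"
  define w where "w x = cross3 (h x) (dv g x)" for x
  have sf: "smooth_on \<Sigma> f" and s\<nu>: "smooth_on \<Sigma> \<nu>" using fr unfolding frontal_on_def by auto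
  have U: "open U" "\<phi> ` U \<subseteq> \<Sigma>" "smooth_on U \<phi>" using lc unfolding local_coords_def by auto
  have sh: "smooth_on U h" using af unfolding adapted_frame_def by simp
  have \<phi>: "\<phi> differentiable (at x)" if "x \<in> U" for x
    using smooth_on_differentiable[OF U(3) that] .
  have f: "f differentiable (at (\<phi> x))" "\<nu> differentiable (at (\<phi> x))" if "x \<in> U" for x
    using smooth_on_differentiable[OF sf] smooth_on_differentiable[OF s\<nu>] U(2) that by blast+
  have gN: "du g x \<bullet> N x = 0" "dv g x \<bullet> N x = 0" "norm (N x) = 1" if "x \<in> U" for x
  proof -
    have x: "\<phi> x \<in> \<Sigma>" using U(2) that by blast
    then have "du f (\<phi> x) \<bullet> \<nu> (\<phi> x) = 0" "dv f (\<phi> x) \<bullet> \<nu> (\<phi> x) = 0"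
      using fr unfolding frontal_on_def du_def dv_def by auto
    then show "du g x \<bullet> N x = 0" "dv g x \<bullet> N x = 0"
      unfolding g_def N_def du_compose[OF \<phi>[OF that] f(1)[OF that]] dv_compose[OF \<phi>[OF that] f(1)[OF that]]
      by (simp_all add: inner_add_left)
    show "norm (N x) = 1" using fr x unfolding frontal_on_def N_def by simp
  qed
  have w0: "w x \<noteq> 0" if "x \<in> U" for x
  proof -
    have "lin_indep_pair (h x) (dv g x)" using af that unfolding adapted_frame_def g_def by simp
    then show ?thesis unfolding w_def by (rule frame_cross_nonzero)
  qed
  have gu: "du g x = snd x *\<^sub>R h x - e (fst x) *\<^sub>R dv g x" if "x \<in> U" for x
    using af that unfolding adapted_frame_def g_def by (cases x) (auto simp: eq_diff_eq)
  have n: "n x = w x /\<^sub>R norm (w x)" for x unfolding n_def adapted_normal_def w_def ..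
  have nn: "n x \<bullet> n x = 1" if "x \<in> U" for x
    using w0[OF that] by (simp add: n dot_square_norm power2_eq_square)
  let ?T = "U \<inter> {x. snd x \<noteq> 0}"
  have T: "open ?T" using U(1) by (intro open_Int open_Collect_neq continuous_intros)
  \<comment> \<open>Off the axis \<open>h\<close> is a combination of the two partial derivatives of
    \<open>g\<close>, so \<open>N\<close> is orthogonal to both factors of \<open>w\<close> and
    hence parallel to \<open>w\<close>. The double cross product formula extracts the
    coefficient.\<close>
  have sN: "n x = (n x \<bullet> N x) *\<^sub>R N x" if "x \<in> ?T" for x
  proof -
    have x: "x \<in> U" "snd x \<noteq> 0" using that by auto
    have "N x \<bullet> dv g x = 0" "N x \<bullet> h x = 0"
      using gN[OF x(1)] gu[OF x(1)] x(2) by (simp_all add: inner_diff_right inner_commute)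
    then have "cross3 (N x) (w x) = 0" unfolding w_def Lagrange by simp
    then have "cross3 (N x) (cross3 (N x) (w x)) = 0" by simp
    then have wN: "(N x \<bullet> w x) *\<^sub>R N x = w x"
      using gN(3)[OF x(1)] unfolding Lagrange by (simp add: dot_square_norm)
    have "(n x \<bullet> N x) *\<^sub>R N x = inverse (norm (w x)) *\<^sub>R ((N x \<bullet> w x) *\<^sub>R N x)"
      by (simp add: n inner_commute)
    then show ?thesis unfolding wN by (simp add: n)
  qed
  have "w differentiable (at q)" unfolding w_def g_def
    by (intro differentiable_cross3 smooth_on_differentiable[OF sh q(1)]
        dv_compose_differentiable[OF U(1,3,2) sf q(1)])
  then have nd: "n differentiable (at q)"
    using w0[OF q(1)] unfolding n
    by (intro differentiable_scaleR differentiable_inverse differentiable_compose[of norm w]) auto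
  have Nd: "N differentiable (at q)"
    unfolding N_def by (rule differentiable_chain_at[OF \<phi>[OF q(1)] f(2)[OF q(1)]])
  have qT: "q \<in> ?T" using q by simp
  \<comment> \<open>The inner product of \<open>sN\<close> with \<open>n q\<close> yields the
    square, and \<open>n q\<close> is a unit vector.\<close>
  have s1: "(n q \<bullet> N q)\<^sup>2 = 1"
    using nn[OF q(1)] sN[OF qT] by (metis inner_commute inner_scaleR_right power2_eq_square)
  have K1: "gaussian_curvature g n q = gaussian_curvature g N q"
    using differentiable_inner[OF nd Nd]
    by (intro gaussian_curvature_rescale_normal[OF T qT sN _ Nd s1 gN(1,2)[OF q(1)]])
  \<comment> \<open>The summand of \<open>du g q\<close> along \<open>dv g q\<close> does not
    contribute to the cross product.\<close>
  have guw: "cross3 (du g q) (dv g q) = snd q *\<^sub>R w q"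
    unfolding gu[OF q(1)] w_def by (simp add: Cross3.left_diff_distrib cross_mult_left)
  \<comment> \<open>Lagrange's identity: the Gram determinant is the squared area of the
    parallelogram.\<close>
  have "det (first_form g q) = (norm (cross3 (du g q) (dv g q)))\<^sup>2"
    using norm_cross_dot[of "du g q" "dv g q"] unfolding det_first_form
    by (simp add: power_mult_distrib dot_square_norm)
  then have I: "det (first_form g q) \<noteq> 0" using guw q w0 by simp
  have K2: "gaussian_curvature g N q = gaussian_curvature f \<nu> (\<phi> q)"
    unfolding g_def N_def
    by (rule gaussian_curvature_compose[OF \<phi>[OF q(1)] f[OF q(1)] I[unfolded g_def]])
  have reg: "q \<in> U - singular_set U g" using ad q unfolding adapted_def g_def by auto
  have K3: "gaussian_curvature g n q = \<kappa> q * \<kappa>t q"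
    using pc reg I unfolding principal_curvature_data_def g_def n_def
    by (intro gaussian_curvature_eq_prod) auto
  have "signed_area_density g n q = cross3 (du g q) (dv g q) \<bullet> n q"
    unfolding signed_area_density_def dot_cross_det[symmetric]
    by (metis cross_triple inner_commute)
  also have "\<dots> = snd q * norm (w q)"
    using w0[OF q(1)] unfolding guw n by (simp add: dot_square_norm power2_eq_square)
  finally have "signed_area_density g n q = snd q * norm (w q)" .
  moreover have "\<kappa>h q = signed_area_density g n q * \<kappa>t q"
    using pc reg unfolding principal_curvature_data_def g_def n_def by blast
  ultimately show ?thesis using K1 K2 K3 unfolding w_def g_def by simp
qed

section \<open>Regular points and transition maps between coordinate systems\<close>

text \<open>If the composite differential is injective, so is that of \<open>\<phi>\<close>, which
  is then onto by equality of dimensions; thus the differential of \<open>f\<close> is injective on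
  the whole plane. It transfers regularity from adapted coordinates to the original domain.\<close>

lemma regular_point_image:
  assumes "local_coords \<Sigma> p U \<phi>" "smooth_on \<Sigma> f" "q \<in> U" "q \<notin> singular_set U (f \<circ> \<phi>)"
  shows "\<phi> q \<notin> singular_set \<Sigma> f"
proof -
  have U: "\<phi> ` U \<subseteq> \<Sigma>" "smooth_on U \<phi>" using assms(1) unfolding local_coords_def by auto
  have \<phi>: "\<phi> differentiable (at q)" using smooth_on_differentiable[OF U(2) assms(3)] .
  have f: "f differentiable (at (\<phi> q))" using smooth_on_differentiable[OF assms(2)] U(1) assms(3) by blast
  let ?D = "frechet_derivative \<phi> (at q)" and ?E = "frechet_derivative f (at (\<phi> q))"
  have inj: "inj (?E \<circ> ?D)"
    using assms(3,4) frechet_derivative_compose[OF \<phi> f] unfolding singular_set_def immersion_at_def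
    using differentiable_chain_at[OF \<phi> f] by auto
  then have "inj ?D" by (rule inj_on_imageI2)
  then have "surj ?D" using linear_injective_imp_surjective[OF linear_frechet_derivative[OF \<phi>]] by blast
  then have "inj ?E" using inj by (metis comp_inj_on_iff inj_on_imageI)
  then show ?thesis using f unfolding singular_set_def immersion_at_def by simp
qed

text \<open>The transition in the opposite direction is a local inverse, and its derivative is a
  right inverse of \<open>A\<close> by the chain rule.\<close>

lemma local_coords_transition:
  assumes \<phi>: "local_coords \<Sigma> p U \<phi>" and \<psi>: "local_coords \<Sigma> p V \<psi>"
  obtains A where "((inv_into U \<phi> \<circ> \<psi>) has_derivative A) (at (0, 0))" "surj A"
    "(inv_into U \<phi> \<circ> \<psi>) (0, 0) = (0, 0)"
    "\<forall>\<^sub>F x in nhds (0, 0). x \<in> V \<and> inv_into U \<phi> (\<psi> x) \<in> U \<and> \<phi> (inv_into U \<phi> (\<psi> x)) = \<psi> x"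
proof -
  \<comment> \<open>The charts are quantified afresh so that the fact serves both directions of the
    transition.\<close>
  have trans: "\<exists>A. ((inv_into U \<phi> \<circ> \<psi>) has_derivative A) (at (0, 0)) \<and>
    (inv_into U \<phi> \<circ> \<psi>) (0, 0) = (0, 0) \<and>
    (\<forall>\<^sub>F x in nhds (0, 0). x \<in> V \<and> inv_into U \<phi> (\<psi> x) \<in> U \<and> \<phi> (inv_into U \<phi> (\<psi> x)) = \<psi> x)"
    if "local_coords \<Sigma> p U \<phi>" "local_coords \<Sigma> p V \<psi>" for U V \<phi> \<psi>
  proof -
    have U: "open U" "(0, 0) \<in> U" "\<phi> (0, 0) = p" "open (\<phi> ` U)" "inj_on \<phi> U"
        "smooth_on (\<phi> ` U) (inv_into U \<phi>)"
      and V: "open V" "(0, 0) \<in> V" "\<psi> (0, 0) = p" "smooth_on V \<psi>"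
      using that unfolding local_coords_def by auto
    have p: "p \<in> \<phi> ` U" using U by blast
    have d\<psi>: "\<psi> differentiable (at (0, 0))" using V by (blast intro: smooth_on_differentiable)
    have "inv_into U \<phi> differentiable (at (\<psi> (0, 0)))"
      using U V p by (auto intro: smooth_on_differentiable)
    then obtain A where A: "((inv_into U \<phi> \<circ> \<psi>) has_derivative A) (at (0, 0))"
      using differentiable_chain_at[OF d\<psi>] unfolding differentiable_def by blast
    have "isCont \<psi> (0, 0)" using d\<psi> by (rule differentiable_imp_continuous_within)
    then have "\<forall>\<^sub>F x in nhds (0, 0). \<psi> x \<in> \<phi> ` U"
      using U(4) V(3) p by (metis isCont_def topological_tendstoD tendsto_at_iff_tendsto_nhds)
    moreover have "\<forall>\<^sub>F x in nhds (0, 0). x \<in> V" using V(1,2) by (rule eventually_nhds_in_open)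
    ultimately have "\<forall>\<^sub>F x in nhds (0, 0). x \<in> V \<and> inv_into U \<phi> (\<psi> x) \<in> U \<and> \<phi> (inv_into U \<phi> (\<psi> x)) = \<psi> x"
      by eventually_elim (auto simp: inv_into_into f_inv_into_f)
    moreover have "(inv_into U \<phi> \<circ> \<psi>) (0, 0) = (0, 0)" using U V by (metis comp_apply inv_into_f_f)
    ultimately show ?thesis using A by blast
  qed
  obtain A where A: "((inv_into U \<phi> \<circ> \<psi>) has_derivative A) (at (0, 0))"
    "(inv_into U \<phi> \<circ> \<psi>) (0, 0) = (0, 0)"
    "\<forall>\<^sub>F x in nhds (0, 0). x \<in> V \<and> inv_into U \<phi> (\<psi> x) \<in> U \<and> \<phi> (inv_into U \<phi> (\<psi> x)) = \<psi> x"
    using trans[OF \<phi> \<psi>] by blast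
  obtain B where B: "((inv_into V \<psi> \<circ> \<phi>) has_derivative B) (at (0, 0))"
    "(inv_into V \<psi> \<circ> \<phi>) (0, 0) = (0, 0)"
    "\<forall>\<^sub>F x in nhds (0, 0). x \<in> U \<and> inv_into V \<psi> (\<phi> x) \<in> V \<and> \<psi> (inv_into V \<psi> (\<phi> x)) = \<phi> x"
    using trans[OF \<psi> \<phi>] by blast
  have "((\<lambda>x. (inv_into U \<phi> \<circ> \<psi>) ((inv_into V \<psi> \<circ> \<phi>) x)) has_derivative (\<lambda>X. A (B X))) (at (0, 0))"
    by (rule has_derivative_compose[OF B(1)]) (simp only: B(2) A(1))
  moreover have "\<forall>\<^sub>F x in nhds (0, 0). (inv_into U \<phi> \<circ> \<psi>) ((inv_into V \<psi> \<circ> \<phi>) x) = x"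
    using B(3) by eventually_elim (use \<phi> in \<open>simp add: local_coords_def\<close>)
  then obtain T where "open T" "(0, 0) \<in> T"
    "\<And>x. x \<in> T \<Longrightarrow> (inv_into U \<phi> \<circ> \<psi>) ((inv_into V \<psi> \<circ> \<phi>) x) = x"
    unfolding eventually_nhds by blast
  ultimately have "((\<lambda>x. x) has_derivative (\<lambda>X. A (B X))) (at (0, 0))"
    by (rule has_derivative_transform_within_open)
  then have "(\<lambda>X. A (B X)) = (\<lambda>x. x)" using has_derivative_unique has_derivative_ident by blast
  then have "surj A" by (metis surjI)
  then show thesis using that A by blast
qed

theorem proposition4p3:
  fixes \<Sigma> :: "(real \<times> real) set"
    and f \<nu> :: "real \<times> real \<Rightarrow> real^3"
    and p :: "real \<times> real"
  assumes "open \<Sigma>" and "connected \<Sigma>"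
    and "front_on \<Sigma> f \<nu>"
    and "p \<in> \<Sigma>"
    and "second_kind \<Sigma> f \<nu> p"
    and "rationally_continuous \<Sigma> (singular_set \<Sigma> f) (gaussian_curvature f \<nu>) p"
  shows "sub_parabolic \<Sigma> f p"
  unfolding sub_parabolic_def
proof (intro allI impI)
  fix U \<phi> e h \<kappa> \<kappa>t \<kappa>h
  assume lc: "local_coords \<Sigma> p U \<phi>" and sa: "strongly_adapted U (f \<circ> \<phi>)"
    and af: "adapted_frame U (f \<circ> \<phi>) e h"
    and pc: "principal_curvature_data U (f \<circ> \<phi>) (adapted_normal (f \<circ> \<phi>) h) \<kappa> \<kappa>t \<kappa>h"
  define \<delta> where "\<delta> q = norm (cross3 (h q) (dv (f \<circ> \<phi>) q))" for q
  have fr: "frontal_on \<Sigma> f \<nu>" using assms(3) unfolding front_on_def by simp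
  then have sf: "smooth_on \<Sigma> f" unfolding frontal_on_def by simp
  have ad: "adapted U (f \<circ> \<phi>)" using sa unfolding strongly_adapted_def by simp
  have U: "open U" "(0, 0) \<in> U" "smooth_on U \<phi>" "\<phi> ` U \<subseteq> \<Sigma>" using lc unfolding local_coords_def by auto
  have s\<kappa>: "smooth_on U \<kappa>" "smooth_on U \<kappa>h" using pc unfolding principal_curvature_data_def by auto
  have sh: "smooth_on U h" using af unfolding adapted_frame_def by simp
  have \<kappa>: "(\<kappa> has_derivative frechet_derivative \<kappa> (at (0, 0))) (at (0, 0))"
    using smooth_on_differentiable[OF s\<kappa>(1) U(2)] frechet_derivative_works by blast
  have \<kappa>h: "isCont \<kappa>h (0, 0)"
    using smooth_on_differentiable[OF s\<kappa>(2) U(2)] by (rule differentiable_imp_continuous_within)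
  have "(\<lambda>q. cross3 (h q) (dv (f \<circ> \<phi>) q)) differentiable (at (0, 0))"
    by (intro differentiable_cross3 smooth_on_differentiable[OF sh U(2)]
        dv_compose_differentiable[OF U(1,3,4) sf U(2)])
  then have \<delta>: "isCont \<delta> (0, 0)"
    unfolding \<delta>_def by (intro continuous_norm differentiable_imp_continuous_within)
  obtain a b c where rr: "rational_repr \<Sigma> (singular_set \<Sigma> f) (gaussian_curvature f \<nu>) p a b"
    and c: "\<And>\<theta>. b 0 \<theta> \<noteq> 0 \<Longrightarrow> a 0 \<theta> / b 0 \<theta> = c"
    using assms(6) unfolding rationally_continuous_def by blast
  obtain V \<psi> \<epsilon> where \<psi>: "local_coords \<Sigma> p V \<psi>" and \<epsilon>: "\<epsilon> > 0"
    and a: "continuous_on ({0..<\<epsilon>} \<times> UNIV) (\<lambda>(r, \<theta>). a r \<theta>)"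
    and b: "continuous_on ({0..<\<epsilon>} \<times> UNIV) (\<lambda>(r, \<theta>). b r \<theta>)"
    and fin: "finite {\<theta> \<in> {0..<2 * pi}. b 0 \<theta> = 0}"
    and K: "\<And>r \<theta>. \<lbrakk>0 < r; r < \<epsilon>; b r \<theta> \<noteq> 0; (r * cos \<theta>, r * sin \<theta>) \<in> V;
      \<psi> (r * cos \<theta>, r * sin \<theta>) \<notin> singular_set \<Sigma> f\<rbrakk> \<Longrightarrow>
      gaussian_curvature f \<nu> (\<psi> (r * cos \<theta>, r * sin \<theta>)) = a r \<theta> / b r \<theta>"
    using rr unfolding rational_repr_def by auto
  \<comment> \<open>From the coordinates of the rational representation to the strongly adapted
    ones.\<close>
  define m where "m = inv_into U \<phi> \<circ> \<psi>"
  obtain A where m: "(m has_derivative A) (at (0, 0))" "surj A" "m (0, 0) = (0, 0)"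
    and ev: "\<forall>\<^sub>F x in nhds (0, 0). x \<in> V \<and> m x \<in> U \<and> \<phi> (m x) = \<psi> x"
    using local_coords_transition[OF lc \<psi>] unfolding m_def comp_def by metis
  have "\<forall>\<^sub>F r in at_right 0. b r \<theta> \<noteq> 0 \<longrightarrow> snd (m (r * cos \<theta>, r * sin \<theta>)) \<noteq> 0 \<longrightarrow>
      snd (m (r * cos \<theta>, r * sin \<theta>)) * \<delta> (m (r * cos \<theta>, r * sin \<theta>)) * (a r \<theta> / b r \<theta>) =
      \<kappa> (m (r * cos \<theta>, r * sin \<theta>)) * \<kappa>h (m (r * cos \<theta>, r * sin \<theta>))" for \<theta>
  proof -
    have "\<forall>\<^sub>F r in at_right 0. (r * cos \<theta>, r * sin \<theta>) \<in> V \<and> m (r * cos \<theta>, r * sin \<theta>) \<in> U \<and>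
        \<phi> (m (r * cos \<theta>, r * sin \<theta>)) = \<psi> (r * cos \<theta>, r * sin \<theta>)"
      using eventually_compose_filterlim[OF ev ray_tendsto] .
    moreover have "\<forall>\<^sub>F r in at_right 0. r < \<epsilon>"
      using \<epsilon> eventually_at_right_field by blast
    moreover have "\<forall>\<^sub>F r in at_right 0. (0::real) < r" by (rule eventually_at_right_less)
    ultimately show ?thesis
    proof eventually_elim
      case (elim r)
      define x where "x = (r * cos \<theta>, r * sin \<theta>)"
      show ?case unfolding x_def[symmetric]
      proof (intro impI)
        assume br: "b r \<theta> \<noteq> 0" and v: "snd (m x) \<noteq> 0"
        have x: "x \<in> V" "m x \<in> U" "\<phi> (m x) = \<psi> x" using elim(1) unfolding x_def by auto
        \<comment> \<open>In adapted coordinates the singular set is exactly the horizontal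
          axis.\<close>
        have "m x \<notin> singular_set U (f \<circ> \<phi>)" using ad v unfolding adapted_def by auto
        then have "\<psi> x \<notin> singular_set \<Sigma> f" using regular_point_image[OF lc sf x(2)] x(3) by simp
        then have "gaussian_curvature f \<nu> (\<phi> (m x)) = a r \<theta> / b r \<theta>"
          using K[OF elim(3,2) br] x(1,3) unfolding x_def by simp
        then show "snd (m x) * \<delta> (m x) * (a r \<theta> / b r \<theta>) = \<kappa> (m x) * \<kappa>h (m x)"
          using curvature_relation[OF fr lc ad af pc x(2) v] unfolding \<delta>_def by simp
      qed
    qed
  qed
  then have zero: "frechet_derivative \<kappa> (at (0, 0)) (1, 0) * \<kappa>h (0, 0) = 0"
    by (rule rational_limit_imp_derivative_0[OF m(1,3,2) \<kappa> \<kappa>h \<delta> \<epsilon> a b fin _ c])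
  let ?n = "adapted_normal (f \<circ> \<phi>) h"
  \<comment> \<open>The first row is \<open>du (f \<circ> \<phi>) (0, 0)\<close>, which vanishes in
    adapted coordinates. Hence the signed area density is 0 at the origin and only the term with
    \<open>\<kappa>h\<close> survives in the principal vector.\<close>
  have "det (vector [0, dv (f \<circ> \<phi>) (0, 0), ?n (0, 0)] :: real^3^3) = 0"
    unfolding dot_cross_det[symmetric] by simp
  then have "signed_area_density (f \<circ> \<phi>) ?n (0, 0) = 0"
    using ad unfolding signed_area_density_def adapted_def by simp
  moreover have "dv (f \<circ> \<phi>) (0, 0) \<bullet> dv (f \<circ> \<phi>) (0, 0) = 1"
    using ad unfolding adapted_def by (simp add: dot_square_norm)
  moreover have "e 0 = 0" using af unfolding adapted_frame_def by simp
  ultimately have "unbounded_principal_vector (f \<circ> \<phi>) e h \<kappa>h (0, 0) = (- \<kappa>h (0, 0)) *\<^sub>R (1, 0)"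
    unfolding unbounded_principal_vector_def by (simp add: Let_def)
  then show "frechet_derivative \<kappa> (at (0, 0)) (unbounded_principal_vector (f \<circ> \<phi>) e h \<kappa>h (0, 0)) = 0"
    using zero linear_scale[OF has_derivative_linear[OF \<kappa>], of "- \<kappa>h (0, 0)" "(1, 0)"] by auto
qed

end
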